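(* Let $n\ge 0$. For $0\le k\le n$ and $d\in P_n$, the value of the irreducible character $\chi^n_k$ (the trace of $d$ acting on $V^n_k$) is given by $$\chi^n_k(d)=\begin{cases}\binom{\ell}{k}, & \text{if } k\le \ell,\\ 0, & \text{if } k>\ell,\end{cases}$$ where $\ell$ is the number of vertical edges in $d$.
   Context: A rook diagram on $n$ is a graph on two rows of $n$ vertices, each row labeled $1,\dots,n$ from left to right, in which every edge joins a top vertex to a bottom vertex and each vertex lies on at most one edge. It corresponds to the $n\times n$ $0$-$1$ matrix having a $1$ in position $(i,j)$ exactly when top vertex $i$ is joined to bottom vertex $j$. The product of diagrams is the matrix product. A rook diagram is planar if it can be drawn inside the rectangle formed by its vertices without edge crossings. $P_n$ denotes the monoid of planar rook diagrams on $n$, with $P_0=\{\emptyset\}$ the one-element monoid. An edge of $d\in P_n$ is vertical if it connects the $i$th vertex in the top row to the $i$th vertex in the bottom row for some $1\le i\le n$. For $d\in P_n$, $\tau(d)$ and $\beta(d)$ are the sets of vertices in the top and bottom rows, respectively, that are incident to an edge. View $d$ as the bijection $\beta(d)\to\tau(d)$ sending each bottom vertex to the top vertex it is joined to. For $S\subseteq\beta(d)$ put $d(S)=\{d(s): s\in S\}$. $V^n_k$ is the complex vector space with basis $\{v_S : S\subseteq\{1,\dots,n\},\ |S|=k\}$, with $d\in P_n$ acting linearly by $d v_S = v_{d(S)}$ if $S\subseteq\beta(d)$ and $d v_S=0$ otherwise. The character $\chi^n_k$ is the $\mathbb{C}$-valued function on $P_n$ giving the trace of $d\in P_n$ as a linear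 transformation on $V^n_k$. *)

theory Defs
  imports "HOL-Analysis.Analysis" "HOL-Library.Poly_Mapping"
begin

section \<open>Planar rook diagrams\<close>

text \<open>
  A rook diagram on n is represented by its set of edges; the pair (i, j) is the edge
  joining the i-th top vertex to the j-th bottom vertex.
\<close>

definition rook_diagram :: "nat \<Rightarrow> (nat \<times> nat) set \<Rightarrow> bool" where
  "rook_diagram n d \<longleftrightarrow>
     d \<subseteq> {1..n} \<times> {1..n} \<and>
     (\<forall>i j j'. (i, j) \<in> d \<and> (i, j') \<in> d \<longrightarrow> j = j') \<and>
     (\<forall>i i' j. (i, j) \<in> d \<and> (i', j) \<in> d \<longrightarrow> i = i')"

definition top_vertex :: "nat \<Rightarrow> real ^ 2" where
  "top_vertex i = vector [real i, 1]"

definition bottom_vertex :: "nat \<Rightarrow> real ^ 2" where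
  "bottom_vertex j = vector [real j, 0]"

definition vertices :: "nat \<Rightarrow> (real ^ 2) set" where
  "vertices n = top_vertex ` {1..n} \<union> bottom_vertex ` {1..n}"

text \<open>
  Edges are drawn as arbitrary arcs inside the rectangle spanned by the vertices.  An arc meets
  no vertex other than its two ends, and distinct arcs are disjoint; distinct edges of a rook
  diagram share no vertex, so this excludes no common end points.
\<close>

definition planar_drawing ::
  "nat \<Rightarrow> (nat \<times> nat) set \<Rightarrow> (nat \<times> nat \<Rightarrow> real \<Rightarrow> real ^ 2) \<Rightarrow> bool" where
  "planar_drawing n d \<gamma> \<longleftrightarrow>
     (\<forall>(i, j)\<in>d.
        arc (\<gamma> (i, j)) \<and>
        pathstart (\<gamma> (i, j)) = top_vertex i \<and>
        pathfinish (\<gamma> (i, j)) = bottom_vertex j \<and>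
        path_image (\<gamma> (i, j)) \<subseteq> convex hull (vertices n) \<and>
        path_image (\<gamma> (i, j)) \<inter> vertices n = {top_vertex i, bottom_vertex j}) \<and>
     (\<forall>e\<in>d. \<forall>e'\<in>d. e \<noteq> e' \<longrightarrow> path_image (\<gamma> e) \<inter> path_image (\<gamma> e') = {})"

definition planar_rook :: "nat \<Rightarrow> (nat \<times> nat) set set" where
  "planar_rook n = {d. rook_diagram n d \<and> (\<exists>\<gamma>. planar_drawing n d \<gamma>)}"

definition vertical_edges :: "nat \<Rightarrow> (nat \<times> nat) set \<Rightarrow> (nat \<times> nat) set" where
  "vertical_edges n d = {e \<in> d. \<exists>i\<in>{1..n}. e = (i, i)}"

definition rook_top :: "(nat \<times> nat) set \<Rightarrow> nat set" where
  "rook_top d = {i. \<exists>j. (i, j) \<in> d}"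

definition rook_bottom :: "(nat \<times> nat) set \<Rightarrow> nat set" where
  "rook_bottom d = {j. \<exists>i. (i, j) \<in> d}"

text \<open>The bijection from the matched bottom vertices to the matched top vertices.\<close>

definition rook_map :: "(nat \<times> nat) set \<Rightarrow> nat \<Rightarrow> nat" where
  "rook_map d s = (THE i. (i, s) \<in> d)"

lemma rook_map_eq:
  assumes "rook_diagram n d" "(i, s) \<in> d"
  shows "rook_map d s = i"
  using assms unfolding rook_map_def rook_diagram_def by blast

lemma bij_betw_rook_map:
  assumes "rook_diagram n d"
  shows "bij_betw (rook_map d) (rook_bottom d) (rook_top d)"
  unfolding bij_betw_def
proof
  show "inj_on (rook_map d) (rook_bottom d)"
  proof (rule inj_onI)
    fix s t assume "s \<in> rook_bottom d" "t \<in> rook_bottom d" and eq: "rook_map d s = rook_map d t"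
    then obtain i j where ij: "(i, s) \<in> d" "(j, t) \<in> d" by (auto simp: rook_bottom_def)
    with eq rook_map_eq[OF assms] have "i = j" by metis
    with ij assms show "s = t" unfolding rook_diagram_def by blast
  qed
  show "rook_map d ` rook_bottom d = rook_top d"
    using rook_map_eq[OF assms] by (force simp: rook_bottom_def rook_top_def)
qed


section \<open>Traces of linear maps on free complex vector spaces\<close>

definition free_scale :: "complex \<Rightarrow> ('a \<Rightarrow>\<^sub>0 complex) \<Rightarrow> ('a \<Rightarrow>\<^sub>0 complex)" where
  "free_scale c x = Poly_Mapping.map ((*) c) x"

lemma lookup_free_scale [simp]:
  "Poly_Mapping.lookup (free_scale c x) a = c * Poly_Mapping.lookup x a"
  by (simp add: free_scale_def map.rep_eq when_def)

global_interpretation free: vector_space "free_scale :: complex \<Rightarrow> ('a \<Rightarrow>\<^sub>0 complex) \<Rightarrow> _"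
  by unfold_locales (auto intro!: poly_mapping_eqI simp: lookup_add algebra_simps)

text \<open>
  The trace of f on the span of a finite basis B that f maps into itself: the sum of the
  diagonal entries of the matrix of f with respect to B.
\<close>

definition trace_on :: "('a \<Rightarrow>\<^sub>0 complex) set \<Rightarrow> (('a \<Rightarrow>\<^sub>0 complex) \<Rightarrow> ('a \<Rightarrow>\<^sub>0 complex)) \<Rightarrow> complex" where
  "trace_on B f = (\<Sum>b\<in>B. free.representation B (f b) b)"

lemma trace_on_basis_independent:
  assumes fin: "finite B" "finite C"
    and ind: "free.independent B" "free.independent C"
    and span: "free.span B = free.span C"
    and lin: "Vector_Spaces.linear free_scale free_scale f"
    and inv: "f ` free.span B \<subseteq> free.span B"
  shows "trace_on B f = trace_on C f"
proof -
  let ?R = free.representation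
  interpret f: Vector_Spaces.linear free_scale free_scale f by (rule lin)
  have Binv: "f b \<in> free.span B" if "b \<in> free.span B" for b using inv that by blast
  have eqC: "x = (\<Sum>c\<in>C. free_scale (?R C x c) c)" if "x \<in> free.span B" for x
    using free.sum_representation_eq[OF ind(2), of x C] fin span that by simp
  have eqB: "x = (\<Sum>b\<in>B. free_scale (?R B x b) b)" if "x \<in> free.span B" for x
    using free.sum_representation_eq[OF ind(1), of x B] fin that by simp
  have CB: "c \<in> free.span B" if "c \<in> C" for c using that span free.span_base by blast
  have BB: "b \<in> free.span B" if "b \<in> B" for b using that free.span_base by blast
  have 1: "?R B (f b) b = (\<Sum>c\<in>C. ?R C b c * ?R B (f c) b)" if b: "b \<in> B" for b
  proof -
    have "f b = (\<Sum>c\<in>C. free_scale (?R C b c) (f c))"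
      by (subst eqC[OF BB[OF b]]) (simp add: f.sum f.scale)
    then have "?R B (f b) b = ?R B (\<Sum>c\<in>C. free_scale (?R C b c) (f c)) b" by simp
    also have "\<dots> = (\<Sum>c\<in>C. ?R C b c * ?R B (f c) b)"
      by (subst free.representation_sum[OF ind(1)])
         (auto simp: free.representation_scale[OF ind(1)] Binv CB free.span_scale)
    finally show ?thesis .
  qed
  have 2: "?R C (f c) c = (\<Sum>b\<in>B. ?R B (f c) b * ?R C b c)" if c: "c \<in> C" for c
  proof -
    have "?R C (f c) c = ?R C (\<Sum>b\<in>B. free_scale (?R B (f c) b) b) c"
      by (subst eqB[OF Binv[OF CB[OF c]]]) simp
    also have "\<dots> = (\<Sum>b\<in>B. ?R B (f c) b * ?R C b c)"
      by (subst free.representation_sum[OF ind(2)])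
         (use BB span in \<open>auto simp: free.representation_scale[OF ind(2)] free.span_scale\<close>)
    finally show ?thesis .
  qed
  show ?thesis
    unfolding trace_on_def by (simp add: 1 2 sum.swap[of _ B C] mult.commute)
qed


section \<open>The representations and their characters\<close>

definition basis_vec :: "nat set \<Rightarrow> (nat set \<Rightarrow>\<^sub>0 complex)" where
  "basis_vec S = Poly_Mapping.single S 1"

definition V_basis :: "nat \<Rightarrow> nat \<Rightarrow> (nat set \<Rightarrow>\<^sub>0 complex) set" where
  "V_basis n k = basis_vec ` {S. S \<subseteq> {1..n} \<and> card S = k}"

definition V_space :: "nat \<Rightarrow> nat \<Rightarrow> (nat set \<Rightarrow>\<^sub>0 complex) set" where
  "V_space n k = free.span (V_basis n k)"

definition act_basis :: "(nat \<times> nat) set \<Rightarrow> nat set \<Rightarrow> (nat set \<Rightarrow>\<^sub>0 complex)" where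
  "act_basis d S = (if S \<subseteq> rook_bottom d then basis_vec (rook_map d ` S) else 0)"

text \<open>
  The linear extension, given on the free vector space over all sets of naturals; it restricts
  to each of the spaces above by the lemma \<open>act_V_space\<close>.
\<close>

definition act :: "(nat \<times> nat) set \<Rightarrow> (nat set \<Rightarrow>\<^sub>0 complex) \<Rightarrow> (nat set \<Rightarrow>\<^sub>0 complex)" where
  "act d x = (\<Sum>S\<in>Poly_Mapping.keys x. free_scale (Poly_Mapping.lookup x S) (act_basis d S))"

definition rook_character :: "nat \<Rightarrow> nat \<Rightarrow> (nat \<times> nat) set \<Rightarrow> complex" where
  "rook_character n k d = trace_on (V_basis n k) (act d)"

lemma act_basis_vec: "act d (basis_vec S) = act_basis d S"
  by (simp add: act_def basis_vec_def)

lemma linear_act: "Vector_Spaces.linear free_scale free_scale (act d)"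
proof -
  have sup: "act d x = (\<Sum>S\<in>A. free_scale (Poly_Mapping.lookup x S) (act_basis d S))"
    if "finite A" "Poly_Mapping.keys x \<subseteq> A" for A x
    unfolding act_def using that
    by (intro sum.mono_neutral_left) (auto simp: in_keys_iff)
  show ?thesis
    unfolding Vector_Spaces.linear_iff
  proof (intro conjI allI free.vector_space_axioms)
    fix x y :: "nat set \<Rightarrow>\<^sub>0 complex" and c :: complex
    let ?A = "Poly_Mapping.keys x \<union> Poly_Mapping.keys y"
    show "act d (x + y) = act d x + act d y"
      using Poly_Mapping.keys_add[of x y]
      by (simp add: sup[of ?A] lookup_add free.scale_left_distrib sum.distrib)
    have "Poly_Mapping.keys (free_scale c x) \<subseteq> Poly_Mapping.keys x"
      by (auto simp: in_keys_iff)
    then show "act d (free_scale c x) = free_scale c (act d x)"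
      by (simp add: sup[of "Poly_Mapping.keys x"] free.scale_sum_right)
  qed
qed

lemma finite_V_basis: "finite (V_basis n k)"
  by (simp add: V_basis_def)

lemma independent_V_basis: "free.independent (V_basis n k)"
proof -
  have inj: "inj basis_vec"
    by (auto simp: inj_def basis_vec_def poly_mapping_eq_iff fun_eq_iff lookup_single when_def
             split: if_splits)
  show ?thesis
  proof (rule free.independent_if_scalars_zero[OF finite_V_basis])
    fix f :: "(nat set \<Rightarrow>\<^sub>0 complex) \<Rightarrow> complex" and x
    assume 0: "(\<Sum>x\<in>V_basis n k. free_scale (f x) x) = 0" and x: "x \<in> V_basis n k"
    then obtain S where S: "x = basis_vec S" by (auto simp: V_basis_def)
    have "Poly_Mapping.lookup y S = (if y = x then 1 else 0)" if "y \<in> V_basis n k" for y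
      using that S inj by (auto simp: V_basis_def basis_vec_def lookup_single when_def)
    then have "0 = (\<Sum>y\<in>V_basis n k. f y * (if y = x then 1 else 0))"
      using arg_cong[OF 0, of "\<lambda>z. Poly_Mapping.lookup z S"] by (simp add: lookup_sum)
    also have "\<dots> = f x" using x finite_V_basis[of n k] by (simp add: sum.delta if_distrib[of "(*) _"] cong: if_cong)
    finally show "f x = 0" by simp
  qed
qed

lemma act_V_space:
  assumes "rook_diagram n d" "x \<in> V_space n k"
  shows "act d x \<in> V_space n k"
proof -
  interpret a: Vector_Spaces.linear free_scale free_scale "act d" by (rule linear_act)
  have "act d b \<in> V_space n k" if b: "b \<in> V_basis n k" for b
  proof -
    obtain S where S: "b = basis_vec S" "S \<subseteq> {1..n}" "card S = k"
      using b by (auto simp: V_basis_def)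
    show ?thesis
    proof (cases "S \<subseteq> rook_bottom d")
      case True
      have bij: "bij_betw (rook_map d) (rook_bottom d) (rook_top d)"
        by (rule bij_betw_rook_map[OF assms(1)])
      have "card (rook_map d ` S) = k"
        using S True bij by (metis bij_betw_imp_inj_on card_image inj_on_subset)
      moreover have "rook_top d \<subseteq> {1..n}"
        using assms(1) by (auto simp: rook_diagram_def rook_top_def)
      then have "rook_map d ` S \<subseteq> {1..n}"
        using bij True unfolding bij_betw_def by blast
      ultimately show ?thesis
        using True by (auto simp: S act_basis_vec act_basis_def V_space_def V_basis_def
                            intro!: free.span_base)
    qed (simp add: S act_basis_vec act_basis_def V_space_def free.span_zero)
  qed
  then have "act d ` V_basis n k \<subseteq> V_space n k" by blast
  then have "free.span (act d ` V_basis n k) \<subseteq> V_space n k"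
    unfolding V_space_def by (metis free.span_mono free.span_span)
  then show ?thesis
    using assms(2) a.span_image[of "V_basis n k"] unfolding V_space_def by blast
qed

end

theory Submission
  imports Defs
begin

text \<open>
  A diagram \<open>d\<close> sends each basis vector to a basis vector or to zero, so its trace counts the
  \<open>k\<close>-subsets \<open>S\<close> of \<open>\<beta>(d)\<close> with \<open>d(S) = S\<close>.  Planarity makes the bijection of \<open>d\<close> strictly
  increasing (\<open>planar_rook_strict_mono\<close>), and a strictly increasing map of a finite chain into
  itself is the identity (\<open>strict_mono_on_finite_imp_id\<close>).  Hence \<open>d(S) = S\<close> forces every point of
  \<open>S\<close> to be fixed, that is, to carry a vertical edge, and the trace is the number of \<open>k\<close>-subsets of
  the set of vertical edges.

  Since edges are drawn as arbitrary arcs, the monotonicity is a topological fact: two arcs in a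
  rectangle that join its top and bottom sides and whose ends are in opposite orders must meet
  (\<open>crossing_paths_meet\<close>).  This is a form of the Fashoda meet theorem.
\<close>

section \<open>Planarity and order\<close>

text \<open>
  The Fashoda meet theorem needs one path from left to right and one from bottom to top.  Inside
  the strip \<open>0 \<le> y \<le> 1\<close> both paths run between top and bottom, so they are prolonged into the
  larger rectangle with \<open>-1 \<le> y \<le> 2\<close>: \<open>p\<close> by hooks that reach the left side along \<open>y = 2\<close> and the
  right side along \<open>y = -1\<close>, and \<open>q\<close> by vertical segments.  The order of the end points keeps the
  new pieces of \<open>p\<close> apart from those of \<open>q\<close>, so the meeting point lies on the original paths.
\<close>

lemma crossing_paths_meet:
  fixes p q :: "real \<Rightarrow> real ^ 2" and a b a' b' l r :: real
  assumes p: "path p" "pathstart p = vector [a, 1]" "pathfinish p = vector [b, 0]"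
    and q: "path q" "pathstart q = vector [a', 1]" "pathfinish q = vector [b', 0]"
    and pbox: "path_image p \<subseteq> cbox (vector [l, 0]) (vector [r, 1])"
    and qbox: "path_image q \<subseteq> cbox (vector [l, 0]) (vector [r, 1])"
    and less: "a < a'" "b' < b"
  shows "path_image p \<inter> path_image q \<noteq> {}"
proof -
  let ?P = "linepath (vector [l, 2]) (vector [a, 2]) +++ linepath (vector [a, 2]) (vector [a, 1])
    +++ p +++ linepath (vector [b, 0]) (vector [b, -1])
    +++ linepath (vector [b, -1]) (vector [r, -1 :: real]) :: real \<Rightarrow> real ^ 2"
  let ?Q = "linepath (vector [b', -1]) (vector [b', 0]) +++ reversepath q
    +++ linepath (vector [a', 1]) (vector [a', 2 :: real]) :: real \<Rightarrow> real ^ 2"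
  have P: "path_image ?P = closed_segment (vector [l, 2]) (vector [a, 2]) \<union>
      (closed_segment (vector [a, 2]) (vector [a, 1]) \<union> (path_image p \<union>
      (closed_segment (vector [b, 0]) (vector [b, -1]) \<union>
       closed_segment (vector [b, -1]) (vector [r, -1]))))"
    using p by (simp add: path_image_join)
  have Q: "path_image ?Q = closed_segment (vector [b', -1]) (vector [b', 0]) \<union>
      (path_image q \<union> closed_segment (vector [a', 1]) (vector [a', 2]))"
    using q by (simp add: path_image_join)
  have ends: "vector [a, 1] \<in> path_image p" "vector [b, 0] \<in> path_image p"
    "vector [a', 1] \<in> path_image q" "vector [b', 0] \<in> path_image q"
    using p q by (metis pathstart_in_path_image pathfinish_in_path_image)+
  have bounds: "l \<le> a" "a \<le> r" "l \<le> b" "b \<le> r" "l \<le> a'" "a' \<le> r" "l \<le> b'" "b' \<le> r"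
    using ends pbox qbox by (force simp: mem_box_cart forall_2)+
  have pm: "0 \<le> z $ 2" "z $ 2 \<le> 1" "l \<le> z $ 1" "z $ 1 \<le> r" if "z \<in> path_image p" for z
    using that pbox by (force simp: mem_box_cart forall_2)+
  have qm: "0 \<le> z $ 2" "z $ 2 \<le> 1" "l \<le> z $ 1" "z $ 1 \<le> r" if "z \<in> path_image q" for z
    using that qbox by (force simp: mem_box_cart forall_2)+
  have Pm: "z \<in> path_image p \<or> z $ 2 = 2 \<and> l \<le> z $ 1 \<and> z $ 1 \<le> a
      \<or> z $ 1 = a \<and> 1 \<le> z $ 2 \<and> z $ 2 \<le> 2 \<or> z $ 1 = b \<and> -1 \<le> z $ 2 \<and> z $ 2 \<le> 0
      \<or> z $ 2 = -1 \<and> b \<le> z $ 1 \<and> z $ 1 \<le> r" if "z \<in> path_image ?P" for z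
    using that bounds(1,4) unfolding P
    by (elim UnE, simp_all add: segment_horizontal segment_vertical, linarith+)
  have Qm: "z \<in> path_image q \<or> z $ 1 = b' \<and> -1 \<le> z $ 2 \<and> z $ 2 \<le> 0
      \<or> z $ 1 = a' \<and> 1 \<le> z $ 2 \<and> z $ 2 \<le> 2" if "z \<in> path_image ?Q" for z
    using that unfolding Q by (elim UnE, simp_all add: segment_vertical, linarith+)
  have vec2: "z = vector [z $ 1, z $ 2]" for z :: "real ^ 2"
    by (simp add: vec_eq_iff forall_2)
  obtain z where z: "z \<in> path_image ?P" "z \<in> path_image ?Q"
  proof (rule fashoda[of ?P ?Q "vector [l, -1]" "vector [r, 2]"])
    show "path ?P" "path ?Q" using p q by simp_all
    show "path_image ?P \<subseteq> cbox (vector [l, -1]) (vector [r, 2])"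
    proof
      fix z assume "z \<in> path_image ?P"
      then have "l \<le> z $ 1 \<and> z $ 1 \<le> r \<and> -1 \<le> z $ 2 \<and> z $ 2 \<le> 2"
        using Pm[of z] pm[of z] bounds by linarith
      then show "z \<in> cbox (vector [l, -1]) (vector [r, 2])"
        by (simp add: mem_box_cart forall_2)
    qed
    show "path_image ?Q \<subseteq> cbox (vector [l, -1]) (vector [r, 2])"
    proof
      fix z assume "z \<in> path_image ?Q"
      then have "l \<le> z $ 1 \<and> z $ 1 \<le> r \<and> -1 \<le> z $ 2 \<and> z $ 2 \<le> 2"
        using Qm[of z] qm[of z] bounds by linarith
      then show "z \<in> cbox (vector [l, -1]) (vector [r, 2])"
        by (simp add: mem_box_cart forall_2)
    qed
  qed (assumption | simp)+
  \<comment> \<open>If \<open>z\<close> is on a piece added to \<open>q\<close>, the order of the end points keeps it off the pieces added to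
    \<open>p\<close>; then \<open>z\<close> lies in the strip, so it is the end of \<open>q\<close> to which that piece is attached.\<close>
  have "z \<in> path_image q"
  proof -
    have "z \<in> path_image q \<or> z $ 1 = b' \<and> z $ 2 = 0 \<or> z $ 1 = a' \<and> z $ 2 = 1"
      using Qm[OF z(2)] Pm[OF z(1)] pm[of z] less by linarith
    then show ?thesis
      using ends(3,4) vec2[of z] by metis
  qed
  moreover have "z \<in> path_image p"
  proof -
    have "z \<in> path_image p \<or> z $ 1 = a \<and> z $ 2 = 1 \<or> z $ 1 = b \<and> z $ 2 = 0"
      using Pm[OF z(1)] qm[OF calculation] by linarith
    then show ?thesis
      using ends(1,2) vec2[of z] by metis
  qed
  ultimately show ?thesis by blast
qed

lemma convex_hull_vertices_subset:
  "convex hull (vertices n) \<subseteq> cbox (vector [1, 0]) (vector [real n, 1])"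
proof (rule hull_minimal)
  show "vertices n \<subseteq> cbox (vector [1, 0]) (vector [real n, 1])"
    by (auto simp: vertices_def top_vertex_def bottom_vertex_def mem_box_cart forall_2)
qed (rule convex_box)

lemma planar_rook_edges_ordered:
  assumes d: "d \<in> planar_rook n" and e: "(i, j) \<in> d" "(i', j') \<in> d" and less: "j < j'"
  shows "i < i'"
proof (rule ccontr)
  assume "\<not> i < i'"
  moreover have "i \<noteq> i'"
    using d e less by (auto simp: planar_rook_def rook_diagram_def)
  ultimately have "i' < i" by simp
  obtain \<gamma> where \<gamma>: "planar_drawing n d \<gamma>"
    using d by (auto simp: planar_rook_def)
  have edge: "path (\<gamma> (x, y))" "pathstart (\<gamma> (x, y)) = vector [real x, 1]"
    "pathfinish (\<gamma> (x, y)) = vector [real y, 0]"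
    "path_image (\<gamma> (x, y)) \<subseteq> cbox (vector [1, 0]) (vector [real n, 1])"
    if "(x, y) \<in> d" for x y
    using \<gamma> that convex_hull_vertices_subset[of n]
    by (fastforce simp: planar_drawing_def top_vertex_def bottom_vertex_def arc_imp_path)+
  have "path_image (\<gamma> (i', j')) \<inter> path_image (\<gamma> (i, j)) \<noteq> {}"
    using edge[OF e(1)] edge[OF e(2)] \<open>i' < i\<close> less
    by (intro crossing_paths_meet) auto
  then show False
    using \<gamma> e less unfolding planar_drawing_def by (metis Pair_inject less_irrefl)
qed

lemma planar_rook_strict_mono:
  assumes "d \<in> planar_rook n"
  shows "strict_mono_on (rook_bottom d) (rook_map d)"
proof (rule strict_mono_onI)
  fix s t assume "s \<in> rook_bottom d" "t \<in> rook_bottom d" "s < t"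
  moreover have "rook_diagram n d" using assms by (simp add: planar_rook_def)
  ultimately show "rook_map d s < rook_map d t"
    using planar_rook_edges_ordered[OF assms] rook_map_eq by (fastforce simp: rook_bottom_def)
qed

section \<open>Fixed subsets\<close>

text \<open>
  If a point is moved, its image is moved in the same direction; so there is no last point that
  moves up and no first point that moves down.
\<close>

lemma strict_mono_on_finite_imp_id:
  fixes f :: "'a::linorder \<Rightarrow> 'a"
  assumes fin: "finite S" and mono: "strict_mono_on S f" and maps: "f ` S \<subseteq> S" and s: "s \<in> S"
  shows "f s = s"
proof (rule ccontr)
  assume "f s \<noteq> s"
  then consider "f s < s" | "s < f s" by (meson linorder_neqE)
  then show False
  proof cases
    case 1
    let ?A = "{x \<in> S. f x < x}"
    have A: "finite ?A" "?A \<noteq> {}" using fin s 1 by auto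
    then have "Min ?A \<in> ?A" by (rule Min_in)
    moreover from this have "f (Min ?A) \<in> ?A"
      using maps strict_mono_onD[OF mono] by blast
    then have "Min ?A \<le> f (Min ?A)" using A(1) by simp
    ultimately show False by auto
  next
    case 2
    let ?A = "{x \<in> S. x < f x}"
    have A: "finite ?A" "?A \<noteq> {}" using fin s 2 by auto
    then have "Max ?A \<in> ?A" by (rule Max_in)
    moreover from this have "f (Max ?A) \<in> ?A"
      using maps strict_mono_onD[OF mono] by blast
    then have "f (Max ?A) \<le> Max ?A" using A(1) by simp
    ultimately show False by auto
  qed
qed

lemma planar_rook_fixes_set_iff:
  assumes d: "d \<in> planar_rook n" and fin: "finite S"
  shows "S \<subseteq> rook_bottom d \<and> rook_map d ` S = S \<longleftrightarrow> S \<subseteq> {i. (i, i) \<in> d}"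
proof -
  have diag: "rook_diagram n d" using d by (simp add: planar_rook_def)
  show ?thesis
  proof safe
    fix s assume S: "S \<subseteq> rook_bottom d" "rook_map d ` S = S" and s: "s \<in> S"
    have "strict_mono_on S (rook_map d)"
      using planar_rook_strict_mono[OF d] S(1) by (auto simp: monotone_on_def)
    then have "rook_map d s = s"
      using strict_mono_on_finite_imp_id[OF fin] S(2) s by blast
    then show "(s, s) \<in> d"
      using S(1) s rook_map_eq[OF diag] by (auto simp: rook_bottom_def)
  qed (use rook_map_eq[OF diag] in \<open>force simp: rook_bottom_def\<close>)+
qed

section \<open>The character\<close>

lemma basis_vec_eq_iff [simp]: "basis_vec S = basis_vec T \<longleftrightarrow> S = T"
  by (auto simp: basis_vec_def poly_mapping_eq_iff fun_eq_iff lookup_single when_def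
      split: if_splits)

text \<open>
  Each column of the matrix of \<open>d\<close> has at most one nonzero entry, a \<open>1\<close> in row \<open>d(S)\<close>; it lies on
  the diagonal exactly for \<open>d(S) = S\<close>.
\<close>

lemma rook_character_eq_card_fixed:
  assumes diag: "rook_diagram n d"
  shows "rook_character n k d =
    of_nat (card {S. S \<subseteq> {1..n} \<and> card S = k \<and> S \<subseteq> rook_bottom d \<and> rook_map d ` S = S})"
proof -
  let ?I = "{S. S \<subseteq> {1..n} \<and> card S = k}"
  have fin: "finite ?I" by simp
  have coord: "free.representation (V_basis n k) (act d (basis_vec S)) (basis_vec S) =
      (if S \<subseteq> rook_bottom d \<and> rook_map d ` S = S then 1 else 0)" if S: "S \<in> ?I" for S
  proof (cases "S \<subseteq> rook_bottom d")
    case True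
    have bij: "bij_betw (rook_map d) (rook_bottom d) (rook_top d)"
      by (rule bij_betw_rook_map[OF diag])
    have "inj_on (rook_map d) S"
      using bij_betw_imp_inj_on[OF bij] True by (rule inj_on_subset)
    then have "card (rook_map d ` S) = k"
      using S by (simp add: card_image)
    moreover have "rook_top d \<subseteq> {1..n}"
      using diag by (auto simp: rook_diagram_def rook_top_def)
    then have "rook_map d ` S \<subseteq> {1..n}"
      using True bij_betw_imp_surj_on[OF bij] by blast
    ultimately have "basis_vec (rook_map d ` S) \<in> V_basis n k"
      by (auto simp: V_basis_def)
    then show ?thesis
      using True by (simp add: act_basis_vec act_basis_def
          free.representation_basis[OF independent_V_basis])
  qed (simp add: act_basis_vec act_basis_def free.representation_zero)
  have "bij_betw basis_vec ?I (V_basis n k)"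
    by (simp add: bij_betw_def inj_on_def V_basis_def)
  then have "rook_character n k d =
      (\<Sum>S\<in>?I. free.representation (V_basis n k) (act d (basis_vec S)) (basis_vec S))"
    unfolding rook_character_def trace_on_def by (rule sum.reindex_bij_betw[symmetric])
  also have "\<dots> = (\<Sum>S\<in>?I. if S \<subseteq> rook_bottom d \<and> rook_map d ` S = S then 1 else 0)"
    by (rule sum.cong) (simp_all add: coord)
  also have "\<dots> = of_nat (card {S \<in> ?I. S \<subseteq> rook_bottom d \<and> rook_map d ` S = S})"
    using fin by (simp add: sum.If_cases Int_def)
  finally show ?thesis by (simp add: conj_assoc)
qed

theorem theorem5p1:
  fixes n k l :: nat and d :: "(nat \<times> nat) set"
  assumes "k \<le> n" and "d \<in> planar_rook n"
    and "l = card (vertical_edges n d)"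
  shows "rook_character n k d = (if k \<le> l then of_nat (l choose k) else 0)"
proof -
  let ?F = "{i. (i, i) \<in> d}"
  have diag: "rook_diagram n d" using assms(2) by (simp add: planar_rook_def)
  then have F: "?F \<subseteq> {1..n}" by (auto simp: rook_diagram_def)
  then have fin: "finite ?F" by (rule finite_subset) simp
  have "vertical_edges n d = (\<lambda>i. (i, i)) ` ?F"
    using F by (auto simp: vertical_edges_def)
  then have l: "l = card ?F"
    using assms(3) by (simp add: card_image inj_on_def)
  have "{S. S \<subseteq> {1..n} \<and> card S = k \<and> S \<subseteq> rook_bottom d \<and> rook_map d ` S = S} =
      {S. S \<subseteq> ?F \<and> card S = k}"
    using planar_rook_fixes_set_iff[OF assms(2)] F
    by (meson finite_atLeastAtMost finite_subset subset_trans)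
  then have "rook_character n k d = of_nat (card {S. S \<subseteq> ?F \<and> card S = k})"
    using rook_character_eq_card_fixed[OF diag] by simp
  also have "\<dots> = of_nat (l choose k)"
    using n_subsets[OF fin] l by simp
  finally show ?thesis by (simp add: binomial_eq_0)
qed

end
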